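(* Let $r\in\mathbb R$. The Farey lengths are $\ell^r$-summable if and only if $r>1$; that is, $$\sum_{(a,b)\in E}\ell(a,b)^r<\infty$$ if and only if $r>1$.
   Context: The Farey tessellation $\mathfrak F$ is the ideal triangulation of the unit disk $\mathbb D$ (hyperbolic metric) obtained from the ideal triangle with vertices $1,\mathrm i,-1$ by repeated hyperbolic reflections across edges; $E$ is its set of (unoriented) edges, each written $(a,b)$ with $a,b\in\mathbb T$ its endpoints. (Under the Cayley map $z\mapsto-\mathrm i\frac{z+1}{z-1}$ onto the upper half-plane, the edges are the geodesics with endpoints $\frac pq,\frac rs\in\mathbb Q\cup\{\infty\}$ in lowest terms, $\infty=\frac10$, such that $|ps-rq|=1$.) For $(a,b)\in E$, the Farey length $\ell(a,b)$ is the arclength of the shorter of the two arcs of $\mathbb T$ between $a$ and $b$ (so $\ell(-1,1)=\pi$). *)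

theory Defs
  imports "HOL-Complex_Analysis.Contour_Integration"
begin

text \<open>
  Points of the ideal boundary of the hyperbolic disk are complex numbers of norm 1. A hyperbolic
  geodesic is represented by the set of its two endpoints and an ideal triangle by the set of its
  three vertices.

  The hyperbolic reflection of the disk across the geodesic with endpoints \<open>a\<close> and \<open>b\<close> extends to
  the boundary. If \<open>b = - a\<close>, the geodesic is a diameter and the reflection is Euclidean. Otherwise
  the geodesic lies on the circle orthogonal to the unit circle at \<open>a\<close> and \<open>b\<close>; its centre is the
  intersection \<open>c\<close> of the tangent lines at these two points, the square of its radius is
  \<open>\<bar>c\<bar>\<^sup>2 - 1\<close>, and the reflection is the inversion in this circle.
\<close>

definition hyp_reflection :: "complex \<Rightarrow> complex \<Rightarrow> complex \<Rightarrow> complex" where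
  "hyp_reflection a b z =
     (if a + b = 0 then a\<^sup>2 * cnj z
      else let c = 2 * a * b / (a + b)
           in c + of_real ((cmod c)\<^sup>2 - 1) / cnj (z - c))"

lemma hyp_reflection_eq:
  assumes "cmod a = 1" "cmod b = 1" "cmod z = 1" "a \<noteq> b"
  shows "hyp_reflection a b z = (2 * a * b - (a + b) * z) / (a + b - 2 * z)"
proof -
  have nz: "a \<noteq> 0" "b \<noteq> 0" "z \<noteq> 0" using assms by auto
  have cnj_inv: "cnj w = 1 / w" if "cmod w = 1" for w
    using that by (metis complex_cnj_cnj complex_div_cnj div_by_1 mult_1 of_real_1 power_one)
  note ca = cnj_inv[OF assms(1)] and cb = cnj_inv[OF assms(2)] and cz = cnj_inv[OF assms(3)]
  show ?thesis
  proof (cases "a + b = 0")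
    case True
    then have "b = - a" by (simp add: add_eq_0_iff)
    then show ?thesis
      using True nz by (simp add: hyp_reflection_def cz field_simps power2_eq_square)
  next
    case False
    define c where "c = 2 * a * b / (a + b)"
    have cc: "cnj c = 2 / (a + b)"
      using False nz by (simp add: c_def ca cb field_simps)
    have nzd: "a + b - 2 * z \<noteq> 0"
    proof
      assume "a + b - 2 * z = 0"
      then have *: "2 * z = a + b" by simp
      have "cnj (2 * z) = cnj (a + b)" using * by simp
      then have "2 / z = 1 / a + 1 / b" by (simp add: ca cb cz)
      then have "2 * a * b = (a + b) * z" using nz by (simp add: field_simps)
      then have "4 * a * b = (a + b) * (2 * z)" by algebra
      then have "(a - b)\<^sup>2 = 0" unfolding * by (simp add: algebra_simps power2_eq_square)
      then show False using assms(4) by simp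
    qed
    have "hyp_reflection a b z = c + (c * cnj c - 1) / (cnj z - cnj c)"
      using False by (simp add: hyp_reflection_def Let_def c_def[symmetric] flip: complex_norm_square)
    also have d: "cnj z - cnj c = (a + b - 2 * z) / (z * (a + b))"
      using False nz by (simp add: cc cz diff_frac_eq)
    also have "c + (c * cnj c - 1) / ((a + b - 2 * z) / (z * (a + b))) =
               (c * cnj z - 1) / ((a + b - 2 * z) / (z * (a + b)))"
    proof -
      have "cnj z - cnj c \<noteq> 0" unfolding d using False nz nzd by simp
      then have "c + (c * cnj c - 1) / (cnj z - cnj c) = (c * cnj z - 1) / (cnj z - cnj c)"
        by (simp add: add_divide_eq_iff algebra_simps)
      then show ?thesis unfolding d .
    qed
    also have "c * cnj z - 1 = (2 * a * b - (a + b) * z) / (z * (a + b))"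
      using False nz by (simp add: c_def cz diff_divide_distrib mult.commute)
    also have "\<dots> / ((a + b - 2 * z) / (z * (a + b))) = (2 * a * b - (a + b) * z) / (a + b - 2 * z)"
      using False nz nzd by simp
    finally show ?thesis .
  qed
qed

inductive_set farey_triangles :: "complex set set" where
  base: "{1, \<i>, -1} \<in> farey_triangles"
| reflect: "\<lbrakk>T \<in> farey_triangles; a \<in> T; b \<in> T; a \<noteq> b\<rbrakk>
            \<Longrightarrow> hyp_reflection a b ` T \<in> farey_triangles"

definition farey_edges :: "complex set set" where
  "farey_edges = {{a, b} | a b. a \<noteq> b \<and> (\<exists>T\<in>farey_triangles. a \<in> T \<and> b \<in> T)}"

definition arclength :: "(real \<Rightarrow> complex) \<Rightarrow> real" where
  "arclength \<gamma> = integral {0..1} (\<lambda>t. norm (vector_derivative \<gamma> (at t)))"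

text \<open>The arc of the unit circle traversed counterclockwise from \<open>a\<close> to \<open>b\<close>.\<close>

definition ccw_arc :: "complex \<Rightarrow> complex \<Rightarrow> real \<Rightarrow> complex" where
  "ccw_arc a b = part_circlepath 0 1 (Arg2pi a) (Arg2pi a + Arg2pi (b / a))"

lemma arclength_ccw_arc: "arclength (ccw_arc a b) = Arg2pi (b / a)"
  using Arg2pi[of "b / a"]
  by (simp add: arclength_def ccw_arc_def vector_derivative_part_circlepath norm_mult)

text \<open>
  For an edge \<open>{a, b}\<close> the minimum below ranges over the two arcs of the circle between \<open>a\<close> and \<open>b\<close>,
  namely the counterclockwise arc from \<open>a\<close> to \<open>b\<close> and the one from \<open>b\<close> to \<open>a\<close>.
\<close>

definition farey_length :: "complex set \<Rightarrow> real" where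
  "farey_length e = Min {arclength (ccw_arc a b) | a b. a \<in> e \<and> b \<in> e \<and> a \<noteq> b}"

lemma farey_length_pair:
  assumes "a \<noteq> b"
  shows "farey_length {a, b} = min (arclength (ccw_arc a b)) (arclength (ccw_arc b a))"
proof -
  have "{arclength (ccw_arc x y) | x y. x \<in> {a, b} \<and> y \<in> {a, b} \<and> x \<noteq> y} =
        {arclength (ccw_arc a b), arclength (ccw_arc b a)}"
    using assms by auto
  then show ?thesis by (simp add: farey_length_def)
qed

lemma farey_length_diameter: "farey_length {-1, 1} = pi"
  by (simp add: farey_length_pair arclength_ccw_arc Arg2pi_real)

end

theory Submission
  imports Defs
begin

text \<open>
  The inverse Cayley transform sends \<open>p / q\<close> to \<open>cnj w / w\<close> with \<open>w = p + \<i> q\<close>, so Farey edges are pairs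
  of Gaussian integers \<open>u\<close>, \<open>v\<close> (up to sign) with determinant \<open>Im (cnj u * v) = \<plusminus>1\<close>, and the chord
  of such an edge has length \<open>2 / \<bar>u * v\<bar>\<close>. The edges from \<open>\<infinity>\<close> to the integers give a harmonic
  series, hence divergence for \<open>r \<le> 1\<close>. For \<open>r > 1\<close> order an edge so that \<open>\<bar>u\<bar> \<le> \<bar>v\<bar>\<close> and put
  \<open>k = Re (cnj u * v)\<close>, so that \<open>\<bar>u * v\<bar>\<^sup>2 = k\<^sup>2 + 1\<close>. For fixed \<open>u = a + \<i> b\<close> the values of \<open>k\<close> lie in one
  residue class modulo \<open>\<bar>u\<bar>\<^sup>2\<close>, so the edge is determined by \<open>a\<close>, \<open>b\<close> and \<open>m = \<lfloor>k / \<bar>u\<bar>\<^sup>2\<rfloor>\<close>, and its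
  length is at most a constant times \<open>1 / ((1 + \<bar>a\<bar>) (1 + \<bar>b\<bar>) (1 + \<bar>m\<bar>))\<close>. The \<open>r\<close>-th powers of
  these bounds have a finite sum over all integer triples.
\<close>

section \<open>Boundary points and reflections in Gaussian coordinates\<close>

definition rat_pt :: "complex \<Rightarrow> complex" where
  "rat_pt w = cnj w / w"

definition gauss_ints :: "complex set" where
  "gauss_ints = {w. Re w \<in> \<int> \<and> Im w \<in> \<int>}"

lemma gauss_ints_add: "u \<in> gauss_ints \<Longrightarrow> v \<in> gauss_ints \<Longrightarrow> u + v \<in> gauss_ints"
  by (simp add: gauss_ints_def)

lemma gauss_ints_minus: "u \<in> gauss_ints \<Longrightarrow> - u \<in> gauss_ints"
  by (simp add: gauss_ints_def)

lemma rat_pt_minus [simp]: "rat_pt (- w) = rat_pt w"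
  by (simp add: rat_pt_def)

lemma rat_pt_1 [simp]: "rat_pt 1 = 1"
  by (simp add: rat_pt_def)

lemma rat_pt_i: "rat_pt \<i> = -1"
  by (simp add: rat_pt_def)

lemma rat_pt_1_minus_i: "rat_pt (1 - \<i>) = \<i>"
proof -
  have "1 - \<i> \<noteq> 0" by (simp add: complex_eq_iff)
  then show ?thesis by (simp add: rat_pt_def divide_eq_eq algebra_simps)
qed

lemma norm_rat_pt: "w \<noteq> 0 \<Longrightarrow> cmod (rat_pt w) = 1"
  by (simp add: rat_pt_def norm_divide)

text \<open>Over the common denominator \<open>u * v\<close> the numerator is a number minus its
  conjugate, so the chord is governed by the determinant.\<close>

lemma dist_rat_pt:
  assumes "u \<noteq> 0" "v \<noteq> 0"
  shows "cmod (rat_pt u - rat_pt v) = 2 * \<bar>Im (cnj u * v)\<bar> / (cmod u * cmod v)"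
proof -
  have "rat_pt u - rat_pt v = (cnj u * v - cnj (cnj u * v)) / (u * v)"
    using assms by (simp add: rat_pt_def field_simps)
  also have "cnj u * v - cnj (cnj u * v) = complex_of_real (2 * Im (cnj u * v)) * \<i>"
    by (simp only: complex_diff_cnj)
  finally show ?thesis
    by (simp add: norm_divide norm_mult del: times_complex.sel)
qed

text \<open>The reflection is induced by the real-linear map taking \<open>u\<close> to
  \<open>u\<close> and \<open>v\<close> to \<open>- v\<close>: it fixes both endpoints, since
  \<open>rat_pt\<close> ignores signs, and takes \<open>u + v\<close> to
  \<open>u - v\<close>.\<close>

lemma hyp_reflection_rat_pt:
  assumes D: "Im (cnj u * v) \<noteq> 0"
  shows "hyp_reflection (rat_pt u) (rat_pt v) (rat_pt (u + v)) = rat_pt (u - v)"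
    and "hyp_reflection (rat_pt u) (rat_pt v) (rat_pt u) = rat_pt u"
    and "hyp_reflection (rat_pt u) (rat_pt v) (rat_pt v) = rat_pt v"
proof -
  have nz: "u \<noteq> 0" "v \<noteq> 0" using D by auto
  have "u + v \<noteq> 0" "u - v \<noteq> 0"
    using D by (auto simp: add_eq_0_iff)
  note nz = nz this
  have "cmod (rat_pt u - rat_pt v) \<noteq> 0"
    unfolding dist_rat_pt[OF nz(1,2)] using D nz by simp
  then have ne: "rat_pt u \<noteq> rat_pt v" by auto
  note refl = hyp_reflection_eq[OF norm_rat_pt[OF nz(1)] norm_rat_pt[OF nz(2)] norm_rat_pt ne]
  \<comment> \<open>\<open>E\<close> is \<open>- 2 * \<i>\<close> times the determinant. It is a
    factor of both numerator and denominator of the reflection formula, and cancelling it leaves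
    \<open>cnj (u - v) / (u - v)\<close>.\<close>
  define E where "E = u * cnj v - v * cnj u"
  have "E \<noteq> 0"
  proof
    assume "E = 0"
    then have "Im E = 0" by simp
    then show False using D by (simp add: E_def algebra_simps)
  qed
  have 1: "2 * rat_pt u * rat_pt v - (rat_pt u + rat_pt v) * rat_pt (u + v)
          = (cnj u - cnj v) * E / (u * v * (u + v))"
    using nz by (simp add: rat_pt_def E_def divide_simps) algebra
  have 2: "rat_pt u + rat_pt v - 2 * rat_pt (u + v) = (u - v) * E / (u * v * (u + v))"
    using nz by (simp add: rat_pt_def E_def divide_simps) algebra
  show "hyp_reflection (rat_pt u) (rat_pt v) (rat_pt (u + v)) = rat_pt (u - v)"
    unfolding refl[OF nz(3)] 1 2 using nz \<open>E \<noteq> 0\<close> by (simp add: rat_pt_def)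
  show "hyp_reflection (rat_pt u) (rat_pt v) (rat_pt u) = rat_pt u"
    unfolding refl[OF nz(1)] using ne by (simp add: divide_simps) (simp add: algebra_simps)
  show "hyp_reflection (rat_pt u) (rat_pt v) (rat_pt v) = rat_pt v"
    unfolding refl[OF nz(2)] using ne by (simp add: divide_simps) (simp add: algebra_simps)
qed

section \<open>Unimodular bases and Farey triangles\<close>

text \<open>The absolute value makes the notion stable under swaps and sign changes, neither of
  which alters the edge.\<close>

definition farey_basis :: "complex \<Rightarrow> complex \<Rightarrow> bool" where
  "farey_basis u v \<longleftrightarrow> u \<in> gauss_ints \<and> v \<in> gauss_ints \<and> \<bar>Im (cnj u * v)\<bar> = 1"

lemma farey_basis_swap: "farey_basis u v \<Longrightarrow> farey_basis v u"
  by (auto simp: farey_basis_def algebra_simps)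

lemma farey_basis_minus: "farey_basis u v \<Longrightarrow> farey_basis u (- v)"
  by (auto simp: farey_basis_def gauss_ints_minus)

lemma farey_basis_add: "farey_basis u v \<Longrightarrow> farey_basis u (u + v)"
  by (auto simp: farey_basis_def gauss_ints_add algebra_simps)

text \<open>The three vertices play symmetric roles, as \<open>u\<close>, \<open>v\<close> and \<open>- u - v\<close> sum to zero.\<close>

lemma farey_triangle_pair:
  assumes "farey_basis u v" "a \<in> {rat_pt u, rat_pt v, rat_pt (u + v)}"
    "b \<in> {rat_pt u, rat_pt v, rat_pt (u + v)}" "a \<noteq> b"
  shows "\<exists>u' v'. farey_basis u' v' \<and> a = rat_pt u' \<and> b = rat_pt v' \<and>
           {rat_pt u, rat_pt v, rat_pt (u + v)} = {rat_pt u', rat_pt v', rat_pt (u' + v')}"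
proof -
  have *: "rat_pt (- u - v) = rat_pt (u + v)"
    using rat_pt_minus[of "u + v"] by (simp add: algebra_simps)
  have m1: "farey_basis u (- u - v)" "farey_basis v (- u - v)"
    using assms(1) farey_basis_minus[OF farey_basis_add, of u v]
      farey_basis_minus[OF farey_basis_add[OF farey_basis_swap], of u v]
    by (auto simp: algebra_simps)
  have s: "farey_basis v u" "farey_basis (- u - v) u" "farey_basis (- u - v) v"
    using assms(1) m1 farey_basis_swap by blast+
  consider "a = rat_pt u" "b = rat_pt v" | "a = rat_pt v" "b = rat_pt u"
    | "a = rat_pt u" "b = rat_pt (- u - v)" | "a = rat_pt (- u - v)" "b = rat_pt u"
    | "a = rat_pt v" "b = rat_pt (- u - v)" | "a = rat_pt (- u - v)" "b = rat_pt v"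
    using assms(2-4) unfolding * by auto
  then show ?thesis
  proof cases
    case 1 then show ?thesis using assms(1) by blast
  next
    case 2 then show ?thesis using s(1) by (metis add.commute insert_commute)
  next
    case 3 with m1(1) * show ?thesis by (intro exI[of _ u] exI[of _ "- u - v"]) auto
  next
    case 4 with s(2) * show ?thesis by (intro exI[of _ "- u - v"] exI[of _ u]) auto
  next
    case 5 with m1(2) * show ?thesis by (intro exI[of _ v] exI[of _ "- u - v"]) auto
  next
    case 6 with s(3) * show ?thesis by (intro exI[of _ "- u - v"] exI[of _ v]) auto
  qed
qed

text \<open>Induction along reflections: any side can be taken as \<open>u\<close>,
  \<open>v\<close>, and reflecting across it amounts to replacing \<open>v\<close> by
  \<open>- v\<close>.\<close>

lemma farey_triangles_rat_pt:
  assumes "T \<in> farey_triangles"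
  shows "\<exists>u v. farey_basis u v \<and> T = {rat_pt u, rat_pt v, rat_pt (u + v)}"
  using assms
proof induction
  case base
  have "farey_basis 1 (- \<i>)"
    by (simp add: farey_basis_def gauss_ints_def)
  moreover have "{1, \<i>, -1} = {rat_pt 1, rat_pt (- \<i>), rat_pt (1 + - \<i>)}"
    by (auto simp: rat_pt_i rat_pt_1_minus_i)
  ultimately show ?case by blast
next
  case (reflect T a b)
  then obtain u v where uv: "farey_basis u v" "a = rat_pt u" "b = rat_pt v"
    "T = {rat_pt u, rat_pt v, rat_pt (u + v)}"
    using farey_triangle_pair by metis
  then have "Im (cnj u * v) \<noteq> 0"
    by (auto simp: farey_basis_def)
  from hyp_reflection_rat_pt[OF this] uv
  have "hyp_reflection a b ` T = {rat_pt u, rat_pt (- v), rat_pt (u + - v)}"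
    by auto
  with farey_basis_minus[OF uv(1)] show ?case by blast
qed


section \<open>Arclength against chord length\<close>

text \<open>If the shorter arc is \<open>2 * t\<close>, the chord is \<open>2 * sin t\<close>, so
  the claim reduces to \<open>sin t \<le> t \<le> 3 * sin t\<close> on
  \<open>[0, pi / 2]\<close>.\<close>

lemma farey_length_bounds:
  assumes "cmod a = 1" "cmod b = 1" "a \<noteq> b"
  shows "cmod (a - b) \<le> farey_length {a, b}" "farey_length {a, b} \<le> 3 * cmod (a - b)"
proof -
  define \<theta> where "\<theta> = Arg2pi (b / a)"
  have nz: "a \<noteq> 0" "b \<noteq> 0" using assms by auto
  have \<theta>: "0 \<le> \<theta>" "\<theta> < 2 * pi" "b / a = exp (\<i> * of_real \<theta>)"
    using Arg2pi[of "b / a"] assms by (auto simp: \<theta>_def is_Arg_def norm_divide)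
  have inv: "Arg2pi (a / b) = 2 * pi - \<theta>"
  proof (cases "b / a \<in> \<real>")
    case True
    \<comment> \<open>A real quotient forces \<theta> to be \<open>pi\<close>, which equals its own
      complement in \<open>2 * pi\<close>.\<close>
    then have "\<theta> = 0 \<or> \<theta> = pi" unfolding \<theta>_def using Arg2pi_eq_0_pi by blast
    moreover have "\<theta> \<noteq> 0" using \<theta>(3) assms(3) nz by auto
    ultimately show ?thesis
      using True Arg2pi_inverse[of "b / a"] by (auto simp: \<theta>_def)
  next
    case False
    then show ?thesis using Arg2pi_inverse[of "b / a"] by (simp add: \<theta>_def)
  qed
  have len: "farey_length {a, b} = min \<theta> (2 * pi - \<theta>)"
    using assms(3) by (simp add: farey_length_pair arclength_ccw_arc \<theta>_def[symmetric] inv)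
  define t where "t = min \<theta> (2 * pi - \<theta>) / 2"
  have t: "0 \<le> t" "t \<le> pi / 2" using \<theta> by (auto simp: t_def)
  have "a - b = a * (1 - b / a)" using nz by (simp add: field_simps)
  then have "cmod (a - b) = cmod (exp (\<i> * of_real \<theta>) - 1)"
    using assms by (simp add: norm_mult \<theta>(3) norm_minus_commute)
  also have "\<dots> = 2 * \<bar>sin (\<theta> / 2)\<bar>" by (rule dist_exp_i_1)
  also have "sin (\<theta> / 2) = sin t"
    by (auto simp: t_def min_def diff_divide_distrib)
  finally have chord: "cmod (a - b) = 2 * sin t"
    using t sin_ge_zero[of t] by simp
  show "cmod (a - b) \<le> farey_length {a, b}"
    using sin_x_le_x[OF t(1)] by (simp add: chord len t_def)
  \<comment> \<open>Taylor gives \<open>t - sin t \<le> t ^ 3 / 6\<close>; as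
    \<open>t \<le> 2\<close>, this is at most \<open>2 * t / 3\<close>, whence
    \<open>t \<le> 3 * sin t\<close>.\<close>
  have "\<bar>sin t - (\<Sum>m<3. sin_coeff m * t ^ m)\<bar> \<le> inverse (fact 3) * \<bar>t\<bar> ^ 3"
    by (rule Maclaurin_sin_bound)
  then have "\<bar>sin t - t\<bar> * 6 \<le> t ^ 3"
    using t by (simp add: eval_nat_numeral sin_coeff_def)
  then have "6 * (t - sin t) \<le> t ^ 3" by argo
  moreover have "t ^ 3 \<le> 4 * t"
  proof -
    have "t \<le> 2" using t pi_less_4 by linarith
    then have "t\<^sup>2 \<le> 2\<^sup>2" using t by (intro power_mono) auto
    then have "t * t\<^sup>2 \<le> t * 4" using t by (intro mult_left_mono) auto
    then show ?thesis by (simp add: eval_nat_numeral)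
  qed
  ultimately show "farey_length {a, b} \<le> 3 * cmod (a - b)"
    using t by (simp add: chord len t_def)
qed

text \<open>The constants 2 and 6 are the chord constant 2 times the comparison factors 1 and
  3.\<close>

lemma farey_length_rat_pt:
  assumes "\<bar>Im (cnj u * v)\<bar> = 1"
  shows "rat_pt u \<noteq> rat_pt v"
    and "2 / (cmod u * cmod v) \<le> farey_length {rat_pt u, rat_pt v}"
    and "farey_length {rat_pt u, rat_pt v} \<le> 6 / (cmod u * cmod v)"
proof -
  have nz: "u \<noteq> 0" "v \<noteq> 0" using assms by auto
  have d: "cmod (rat_pt u - rat_pt v) = 2 / (cmod u * cmod v)"
    using dist_rat_pt[OF nz] assms by simp
  show ne: "rat_pt u \<noteq> rat_pt v" using d nz by auto
  note * = farey_length_bounds[OF norm_rat_pt[OF nz(1)] norm_rat_pt[OF nz(2)] ne, unfolded d]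
  show "2 / (cmod u * cmod v) \<le> farey_length {rat_pt u, rat_pt v}"
    and "farey_length {rat_pt u, rat_pt v} \<le> 6 / (cmod u * cmod v)"
    using * by simp_all
qed

section \<open>Integer coordinates of edges\<close>

lemma farey_edge_basis:
  assumes "e \<in> farey_edges"
  shows "\<exists>u v. u \<in> gauss_ints \<and> v \<in> gauss_ints \<and> Im (cnj u * v) = 1 \<and> cmod u \<le> cmod v
           \<and> e = {rat_pt u, rat_pt v}"
proof -
  obtain T a b where T: "T \<in> farey_triangles" "a \<in> T" "b \<in> T" "a \<noteq> b" "e = {a, b}"
    using assms by (auto simp: farey_edges_def)
  with farey_triangles_rat_pt farey_triangle_pair obtain u v where
    uv: "farey_basis u v" "e = {rat_pt u, rat_pt v}" by metis
  \<comment> \<open>Once the norms are ordered, negating \<open>v\<close> corrects the sign of the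
    determinant without changing the order or the edge.\<close>
  have *: "\<exists>u v. u \<in> gauss_ints \<and> v \<in> gauss_ints \<and> Im (cnj u * v) = 1 \<and> cmod u \<le> cmod v
           \<and> e = {rat_pt u, rat_pt v}"
    if "farey_basis u v" "e = {rat_pt u, rat_pt v}" "cmod u \<le> cmod v" for u v
  proof (cases "Im (cnj u * v) = 1")
    case True
    with that show ?thesis by (intro exI[of _ u] exI[of _ v]) (auto simp: farey_basis_def)
  next
    case False
    with that have "Im (cnj u * - v) = 1" by (auto simp: farey_basis_def)
    with that show ?thesis
      by (intro exI[of _ u] exI[of _ "- v"]) (auto simp: farey_basis_def gauss_ints_minus)
  qed
  show ?thesis
  proof (cases "cmod u \<le> cmod v")
    case True
    with *[of u v] uv show ?thesis by blast
  next
    case False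
    with *[of v u] uv farey_basis_swap show ?thesis by (simp add: insert_commute)
  qed
qed

lemma farey_edge_int:
  assumes "e \<in> farey_edges"
  shows "\<exists>a b c d :: int. a * d - b * c = 1 \<and> a\<^sup>2 + b\<^sup>2 \<le> c\<^sup>2 + d\<^sup>2 \<and>
    e = {rat_pt (Complex (of_int a) (of_int b)), rat_pt (Complex (of_int c) (of_int d))}"
proof -
  obtain u v where uv: "u \<in> gauss_ints" "v \<in> gauss_ints" "Im (cnj u * v) = 1" "cmod u \<le> cmod v"
    "e = {rat_pt u, rat_pt v}"
    using farey_edge_basis[OF assms] by blast
  obtain a b where u: "u = Complex (of_int a) (of_int b)"
    using uv(1) by (cases u) (auto simp: gauss_ints_def elim!: Ints_cases)
  obtain c d where v: "v = Complex (of_int c) (of_int d)"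
    using uv(2) by (cases v) (auto simp: gauss_ints_def elim!: Ints_cases)
  have "real_of_int (a * d - b * c) = of_int 1"
    using uv(3) by (simp add: u v)
  then have "a * d - b * c = 1" by (simp only: of_int_eq_iff)
  moreover have "real_of_int (a\<^sup>2 + b\<^sup>2) \<le> of_int (c\<^sup>2 + d\<^sup>2)"
    using uv(4) by (simp add: u v cmod_def)
  then have "a\<^sup>2 + b\<^sup>2 \<le> c\<^sup>2 + d\<^sup>2" by (simp only: of_int_le_iff)
  ultimately show ?thesis using uv(5) u v by blast
qed

section \<open>Coding edges by integer triples\<close>

text \<open>This makes the code \<open>(a, b, m)\<close> of an edge injective: passing to another
  solution shifts the dividend by \<open>t * N\<close>, hence the quotient by
  \<open>t\<close>.\<close>

lemma unimodular_unique:
  fixes a b c d c' d' :: int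
  assumes "a * d - b * c = 1" "a * d' - b * c' = 1"
    "(a * c + b * d) div (a\<^sup>2 + b\<^sup>2) = (a * c' + b * d') div (a\<^sup>2 + b\<^sup>2)"
  shows "c = c'" "d = d'"
proof -
  \<comment> \<open>By Cramer's rule the difference of two solutions is the multiple \<open>t\<close> of \<open>(a, b)\<close>.\<close>
  define N t where "N = a\<^sup>2 + b\<^sup>2" and "t = (c' - c) * d - (d' - d) * c"
  have "a \<noteq> 0 \<or> b \<noteq> 0" using assms(1) by auto
  then have N: "N > 0" by (simp add: N_def sum_power2_gt_zero_iff)
  have c: "c' = c + a * t" and d: "d' = d + b * t"
    unfolding t_def using assms(1,2) by algebra+
  have "a * c' + b * d' = (a * c + b * d) + t * N"
    unfolding c d N_def by (simp add: algebra_simps power2_eq_square)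
  then have "t = 0" using assms(3) N by (simp add: N_def[symmetric])
  then show "c = c'" "d = d'" using c d by auto
qed

text \<open>For quotient 0 or -1 the left side is at most \<open>4 * N\<^sup>2\<close>, which the
  second hypothesis controls. Otherwise
  \<open>N * (1 + \<bar>m\<bar>) \<le> 3 * \<bar>k\<bar>\<close>; the factor 3 comes from
  \<open>m = - 2\<close>, where \<open>1 + \<bar>m\<bar> = 3 * (\<bar>m\<bar> - 1)\<close>.\<close>

lemma abs_div_bound:
  fixes k N :: int
  assumes "N > 0" "N\<^sup>2 \<le> k\<^sup>2 + 1"
  shows "(N * (1 + \<bar>k div N\<bar>))\<^sup>2 \<le> 9 * (k\<^sup>2 + 1)"
proof -
  define m where "m = k div N"
  have k: "m * N \<le> k" "k < (m + 1) * N"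
  proof -
    have "k = m * N + k mod N" by (simp add: m_def)
    moreover have "0 \<le> k mod N" "k mod N < N" using assms(1) by simp_all
    ultimately show "m * N \<le> k" "k < (m + 1) * N" by (simp_all only: distrib_right)
  qed
  have *: ?thesis if "N * (1 + \<bar>m\<bar>) \<le> 3 * \<bar>k\<bar>"
  proof -
    have "(N * (1 + \<bar>m\<bar>))\<^sup>2 \<le> (3 * \<bar>k\<bar>)\<^sup>2"
      using that assms(1) by (intro power_mono) auto
    then show ?thesis by (simp add: m_def power_mult_distrib)
  qed
  consider "m = 0 \<or> m = - 1" | "m \<ge> 1" | "m \<le> - 2" by linarith
  then show ?thesis
  proof cases
    case 1
    then have "(N * (1 + \<bar>m\<bar>))\<^sup>2 \<le> 4 * N\<^sup>2" by (auto simp: power_mult_distrib)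
    also have "\<dots> \<le> 9 * (k\<^sup>2 + 1)" using assms(2) zero_le_power2[of k] by (smt (verit))
    finally show ?thesis by (simp add: m_def)
  next
    case 2
    then have "N * 1 \<le> N * m" using assms(1) by (intro mult_left_mono) auto
    then show ?thesis using 2 k(1) by (intro *) (simp add: algebra_simps)
  next
    case 3
    then have "N * 2 \<le> N * (- m)" using assms(1) by (intro mult_left_mono) auto
    then show ?thesis using 3 k(2) by (intro *) (simp add: algebra_simps)
  qed
qed

text \<open>The constant is 4 times 3: \<open>(1 + \<bar>a\<bar>) * (1 + \<bar>b\<bar>)\<close> is
  at most \<open>4 * N\<close>, and \<open>N * (1 + \<bar>m\<bar>)\<close> is at most 3 times the
  product of the norms.\<close>

lemma unimodular_norm_bound:
  fixes a b c d :: int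
  assumes det: "a * d - b * c = 1" and le: "a\<^sup>2 + b\<^sup>2 \<le> c\<^sup>2 + d\<^sup>2"
  defines "m \<equiv> (a * c + b * d) div (a\<^sup>2 + b\<^sup>2)"
  shows "(1 + \<bar>a\<bar>) * (1 + \<bar>b\<bar>) * (1 + \<bar>m\<bar>) \<le> 12 * (cmod (Complex a b) * cmod (Complex c d))"
proof -
  define k N M where "k = a * c + b * d" and "N = a\<^sup>2 + b\<^sup>2" and "M = c\<^sup>2 + d\<^sup>2"
  have "a \<noteq> 0 \<or> b \<noteq> 0" using det by auto
  then have N: "N \<ge> 1" using sum_power2_gt_zero_iff[of a b] by (simp add: N_def)
  have NM: "N * M = k\<^sup>2 + 1"
    unfolding N_def M_def k_def using det by algebra \<comment> \<open>Lagrange's identity\<close>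
  \<comment> \<open>The ordering of the norms supplies the second hypothesis of
    \<open>abs_div_bound\<close>.\<close>
  have "N * N \<le> N * M" using N le by (intro mult_left_mono) (auto simp: N_def M_def)
  then have "N\<^sup>2 \<le> k\<^sup>2 + 1" using NM by (simp add: power2_eq_square)
  with abs_div_bound[of N k] N have "(N * (1 + \<bar>m\<bar>))\<^sup>2 \<le> 9 * (k\<^sup>2 + 1)"
    by (simp add: m_def N_def k_def)
  then have 1: "(N * (1 + \<bar>m\<bar>))\<^sup>2 \<le> 9 * (N * M)" unfolding NM .
  have "(1 + \<bar>a\<bar>) * (1 + \<bar>b\<bar>) \<le> 4 * N"
  proof -
    have "\<bar>x\<bar> \<le> x\<^sup>2" for x :: int
      using self_le_power[of "\<bar>x\<bar>" 2] by (cases "x = 0") auto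
    from this[of a] this[of b] have "\<bar>a\<bar> + \<bar>b\<bar> \<le> N" by (simp add: N_def)
    moreover have "2 * (\<bar>a\<bar> * \<bar>b\<bar>) \<le> N"
      using zero_le_power2[of "\<bar>a\<bar> - \<bar>b\<bar>"] by (simp add: N_def power2_diff)
    ultimately show ?thesis using N by (simp add: algebra_simps)
  qed
  then have "(1 + \<bar>a\<bar>) * (1 + \<bar>b\<bar>) * (1 + \<bar>m\<bar>) \<le> 4 * N * (1 + \<bar>m\<bar>)"
    by (intro mult_right_mono) auto
  then have "real_of_int ((1 + \<bar>a\<bar>) * (1 + \<bar>b\<bar>) * (1 + \<bar>m\<bar>)) \<le> of_int (4 * (N * (1 + \<bar>m\<bar>)))"
    by (simp only: of_int_le_iff mult.assoc)
  also have "\<dots> = 4 * of_int (N * (1 + \<bar>m\<bar>))" by simp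
  also have "of_int (N * (1 + \<bar>m\<bar>)) \<le> sqrt (of_int (9 * (N * M)))"
    using 1 by (intro real_le_rsqrt) (simp only: of_int_le_iff flip: of_int_power)
  also have "sqrt (of_int (9 * (N * M))) = 3 * (cmod (Complex a b) * cmod (Complex c d))"
    by (simp add: cmod_def real_sqrt_mult N_def M_def)
  finally show ?thesis by simp
qed

section \<open>Summability for exponents above 1\<close>

lemma summable_int_powr:
  fixes r :: real
  assumes "r > 1"
  shows "(\<lambda>n::int. (1 + \<bar>of_int n\<bar>) powr - r) summable_on UNIV"
proof -
  define f where "f n = (1 + \<bar>of_int n\<bar> :: real) powr - r" for n :: int
  have "summable (\<lambda>n. of_nat (Suc n) powr - r :: real)"
    using assms by (subst summable_Suc_iff) (simp add: summable_real_powr_iff)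
  then have "(\<lambda>n. of_nat (Suc n) powr - r :: real) summable_on UNIV"
    by (simp add: summable_on_UNIV_nonneg_real_iff)
  then have nat: "(\<lambda>n::nat. f (int n)) summable_on UNIV" "(\<lambda>n::nat. f (- int n)) summable_on UNIV"
    by (simp_all add: f_def add.commute)
  have "f summable_on range int" "f summable_on range (\<lambda>n. - int n)"
    using nat by (subst summable_on_reindex; simp add: inj_on_def o_def)+
  then have "f summable_on (range int \<union> range (\<lambda>n. - int n))"
    by (rule summable_on_union)
  also have "range int \<union> range (\<lambda>n. - int n) = UNIV"
    by (auto simp: image_iff) (metis int_cases2)
  finally show ?thesis by (simp add: f_def)
qed

text \<open>Tonelli for nonnegative products: each inner sum is \<open>f x\<close> times the fixed
  number \<open>infsum g B\<close>.\<close>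

lemma summable_on_prod_real:
  fixes f :: "'a \<Rightarrow> real" and g :: "'b \<Rightarrow> real"
  assumes "f summable_on A" "g summable_on B" "\<And>x. f x \<ge> 0" "\<And>x. g x \<ge> 0"
  shows "(\<lambda>(x, y). f x * g y) summable_on A \<times> B"
proof -
  have eq: "infsum (\<lambda>y. norm (f x * g y)) B = f x * infsum g B" for x
    using assms(3,4) by (simp add: abs_mult infsum_cmult_right')
  have "infsum g B \<ge> 0" using assms(4) by (rule infsum_nonneg)
  then have "(\<lambda>x. norm (infsum (\<lambda>y. norm (f x * g y)) B)) summable_on A"
    unfolding eq using assms(1,3) by (simp add: abs_mult summable_on_cmult_left)
  moreover have "(\<lambda>y. norm (f x * g y)) summable_on B" for x
    using assms(2-4) by (simp add: abs_mult summable_on_cmult_right)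
  ultimately show ?thesis
    by (intro abs_summable_summable[OF Infinite_Sum.abs_summable_on_Sigma_iff[THEN iffD2]]) simp
qed

lemma farey_summable:
  fixes r :: real
  assumes "r > 1"
  shows "(\<lambda>e. farey_length e powr r) summable_on farey_edges"
proof -
  define P where "P e = (\<lambda>(a, b, c, d :: int). a * d - b * c = 1 \<and> a\<^sup>2 + b\<^sup>2 \<le> c\<^sup>2 + d\<^sup>2 \<and>
    e = {rat_pt (Complex (of_int a) (of_int b)), rat_pt (Complex (of_int c) (of_int d))})" for e
  have "\<forall>e\<in>farey_edges. \<exists>p. P e p"
    using farey_edge_int by (fastforce simp: P_def)
  then obtain q where q: "\<And>e. e \<in> farey_edges \<Longrightarrow> P e (q e)" by metis
  define \<psi> where "\<psi> = (\<lambda>(a, b, c, d). (a, b, (a * c + b * d) div (a\<^sup>2 + b\<^sup>2 :: int)))"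
  define g where "g n = (1 + \<bar>of_int n\<bar> :: real) powr - r" for n :: int
  \<comment> \<open>The nesting to the right lets \<open>summable_on_prod_real\<close> apply
    twice.\<close>
  define G where "G = (\<lambda>(a, p). g a * (case p of (b, m) \<Rightarrow> g b * g m))"
  have inj: "inj_on (\<psi> \<circ> q) farey_edges"
  proof (rule inj_onI)
    fix e e' assume e: "e \<in> farey_edges" "e' \<in> farey_edges" "(\<psi> \<circ> q) e = (\<psi> \<circ> q) e'"
    obtain a b c d where qe: "q e = (a, b, c, d)" by (cases "q e")
    obtain a' b' c' d' where qe': "q e' = (a', b', c', d')" by (cases "q e'")
    have ab: "a' = a" "b' = b"
      and m: "(a * c + b * d) div (a\<^sup>2 + b\<^sup>2) = (a * c' + b * d') div (a\<^sup>2 + b\<^sup>2)"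
      using e(3) by (auto simp: \<psi>_def qe qe')
    have P: "P e (a, b, c, d)" "P e' (a, b, c', d')"
      using q[OF e(1)] q[OF e(2)] by (simp_all add: qe qe' ab)
    then have "c = c'" "d = d'"
      using unimodular_unique[OF _ _ m] by (simp_all add: P_def)
    then show "e = e'" using P by (simp add: P_def)
  qed
  have "g summable_on UNIV" unfolding g_def by (rule summable_int_powr[OF assms])
  moreover have "g x \<ge> 0" for x by (simp add: g_def)
  ultimately have "G summable_on UNIV \<times> UNIV \<times> UNIV"
    unfolding G_def by (intro summable_on_prod_real) (auto split: prod.split)
  then have "G summable_on (\<psi> \<circ> q) ` farey_edges"
    by (rule summable_on_subset_banach) simp
  then have "(\<lambda>e. G ((\<psi> \<circ> q) e)) summable_on farey_edges"
    using summable_on_reindex[OF inj, of G] by (simp add: o_def)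
  \<comment> \<open>72 is 6 times 12, from \<open>farey_length_rat_pt\<close> and
    \<open>unimodular_norm_bound\<close>.\<close>
  then have "(\<lambda>e. 72 powr r * G ((\<psi> \<circ> q) e)) summable_on farey_edges"
    by (rule summable_on_cmult_right)
  then show ?thesis
  proof (rule summable_on_comparison_test)
    fix e assume e: "e \<in> farey_edges"
    obtain a b c d where qe: "q e = (a, b, c, d)" by (cases "q e")
    note p = q[OF e, unfolded qe P_def, simplified]
    define m where "m = (a * c + b * d) div (a\<^sup>2 + b\<^sup>2)"
    define D :: real where "D = (1 + \<bar>of_int a\<bar>) * ((1 + \<bar>of_int b\<bar>) * (1 + \<bar>of_int m\<bar>))"
    define C where "C = cmod (Complex a b) * cmod (Complex c d)"
    have D: "D > 0" by (simp add: D_def add_pos_nonneg)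
    have "real_of_int (a * d - b * c) = 1" using p by simp
    then have "\<bar>Im (cnj (Complex a b) * Complex c d)\<bar> = 1" by simp
    note len = farey_length_rat_pt[OF this]
    have "D \<le> 12 * C"
      using unimodular_norm_bound[of a d b c] p by (simp add: D_def C_def m_def mult.assoc)
    then have "6 / C \<le> 72 / D" using D by (simp add: divide_simps)
    moreover have "farey_length e \<le> 6 / C" "0 \<le> farey_length e"
      using len(2,3) p order_trans[OF _ len(2), of 0] by (auto simp: C_def)
    ultimately have "farey_length e powr r \<le> (72 / D) powr r"
      using assms by (intro powr_mono2) auto
    also have "\<dots> = 72 powr r * D powr - r"
      using D by (simp add: powr_divide powr_minus_divide)
    also have "D powr - r = G ((\<psi> \<circ> q) e)"
      by (simp add: qe \<psi>_def G_def g_def m_def D_def powr_mult)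
    finally show "farey_length e powr r \<le> 72 powr r * G ((\<psi> \<circ> q) e)" .
  qed auto
qed

section \<open>Divergence for exponents at most 1\<close>

text \<open>In the half-plane these are the triangles with vertices \<infinity>, \<open>- n\<close>
  and \<open>- n - 1\<close>; each arises from the previous one by reflection across their common
  vertical side.\<close>

lemma farey_fan:
  "{1, rat_pt (of_nat n - \<i>), rat_pt (of_nat (Suc n) - \<i>)} \<in> farey_triangles"
proof (induction n)
  case 0
  have "{1, rat_pt (of_nat 0 - \<i>), rat_pt (of_nat (Suc 0) - \<i>)} = {1, \<i>, -1}"
    by (auto simp: rat_pt_i rat_pt_1_minus_i)
  then show ?case using farey_triangles.base by simp
next
  case (Suc n)
  define v where "v = of_nat (Suc n) - \<i>"
  \<comment> \<open>Representing \<infinity> by \<open>- 1\<close> instead of \<open>1\<close> makes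
    the sum with \<open>v\<close> the old third vertex and the difference, up to sign, the new
    one.\<close>
  have D: "Im (cnj (- 1) * v) \<noteq> 0" "\<bar>Im (cnj (- 1) * v)\<bar> = 1" by (auto simp: v_def)
  have e: "- 1 + v = of_nat n - \<i>" "- 1 - v = - (of_nat (Suc (Suc n)) - \<i>)"
    by (simp_all add: v_def)
  have "hyp_reflection 1 (rat_pt v) ` {1, rat_pt (of_nat n - \<i>), rat_pt v} \<in> farey_triangles"
    using Suc.IH farey_length_rat_pt(1)[OF D(2)] by (intro farey_triangles.reflect) (auto simp: v_def)
  then show ?case
    using hyp_reflection_rat_pt[OF D(1), unfolded e rat_pt_minus rat_pt_1]
    by (simp add: insert_commute v_def)
qed

lemma farey_not_summable:
  fixes r :: real
  assumes "r \<le> 1"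
  shows "\<not> (\<lambda>e. farey_length e powr r) summable_on farey_edges"
proof
  assume *: "(\<lambda>e. farey_length e powr r) summable_on farey_edges"
  define h where "h n = {1, rat_pt (of_nat n - \<i>)}" for n
  have h: "h n \<in> farey_edges \<and> 1 / real (Suc n) \<le> farey_length (h n)" for n
  proof -
    have D: "\<bar>Im (cnj 1 * (of_nat n - \<i>))\<bar> = 1" by simp
    note len = farey_length_rat_pt[OF D, unfolded rat_pt_1]
    have "h n \<in> farey_edges"
      unfolding farey_edges_def h_def mem_Collect_eq
      by (intro exI[of _ 1] exI[of _ "rat_pt (of_nat n - \<i>)"] conjI refl len(1)
          bexI[OF _ farey_fan[of n]]) simp_all
    moreover have "cmod (of_nat n - \<i>) \<le> real n + 1"
      using norm_triangle_ineq4[of "of_nat n" \<i>] by simp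
    then have "1 / real (Suc n) \<le> 2 / cmod (of_nat n - \<i>)"
      by (intro frac_le) (auto simp: complex_eq_iff)
    ultimately show ?thesis using len(2) by (simp add: h_def)
  qed
  have "inj h"
  proof (rule injI)
    fix m n assume "h m = h n"
    moreover have "rat_pt (of_nat k - \<i>) \<noteq> 1" for k
      using farey_length_rat_pt(1)[of 1 "of_nat k - \<i>"] by auto
    ultimately have eq: "rat_pt (of_nat m - \<i>) = rat_pt (of_nat n - \<i>)"
      by (auto simp: h_def doubleton_eq_iff)
    have "of_nat k - \<i> \<noteq> 0" for k by (simp add: complex_eq_iff)
    \<comment> \<open>The determinant of these two vectors is \<open>n - m\<close>, and a zero chord
      forces it to vanish.\<close>
    with dist_rat_pt[of "of_nat m - \<i>" "of_nat n - \<i>"] eq show "m = n" by simp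
  qed
  have "(\<lambda>n. farey_length (h n) powr r) summable_on UNIV"
  proof -
    have "range h \<subseteq> farey_edges" using h by blast
    with * have "(\<lambda>e. farey_length e powr r) summable_on range h"
      by (rule summable_on_subset_banach)
    then show ?thesis
      unfolding summable_on_reindex[OF \<open>inj h\<close>] o_def .
  qed
  \<comment> \<open>All these lengths are at most 6, so \<open>L / 6\<close> lies in the unit
    interval, where lowering the exponent from 1 to \<open>r\<close> can only increase the power;
    this covers negative \<open>r\<close> as well.\<close>
  then have "(\<lambda>n. 6 * 6 powr - r * farey_length (h n) powr r) summable_on UNIV"
    by (rule summable_on_cmult_right)
  then have "(\<lambda>n. 1 / real (Suc n)) summable_on UNIV"
  proof (rule summable_on_comparison_test)
    fix n :: nat
    define L where "L = farey_length (h n)"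
    have "0 < 1 / real (Suc n)" by simp
    with h[of n] have L: "0 < L" "1 / real (Suc n) \<le> L" unfolding L_def by linarith+
    have "1 \<le> cmod (of_nat n - \<i>)" using abs_Im_le_cmod[of "of_nat n - \<i>"] by simp
    then have "6 / cmod (of_nat n - \<i>) \<le> 6" by (simp add: divide_le_eq)
    then have "L \<le> 6"
      using farey_length_rat_pt(3)[of 1 "of_nat n - \<i>"] by (simp add: L_def h_def)
    then have "(L / 6) powr 1 \<le> (L / 6) powr r"
      using L assms by (intro powr_mono') auto
    moreover have "(L / 6) powr r = 6 powr - r * L powr r"
      using L by (simp add: powr_divide powr_minus_divide)
    ultimately have "L \<le> 6 * 6 powr - r * L powr r"
      using L by simp
    with L show "1 / real (Suc n) \<le> 6 * 6 powr - r * farey_length (h n) powr r"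
      by (simp add: L_def)
  qed auto
  then have "summable (\<lambda>n. inverse (real (Suc n)))"
    by (simp add: summable_on_UNIV_nonneg_real_iff inverse_eq_divide)
  then have "summable (\<lambda>n. inverse (real n))"
    using summable_Suc_iff[of "\<lambda>n. inverse (real n)"] by simp
  then show False
    using not_summable_harmonic[where 'a = real] by simp
qed

theorem proposition4p2:
  fixes r :: real
  shows "(\<lambda>e. farey_length e powr r) summable_on farey_edges \<longleftrightarrow> r > 1"
  using farey_summable farey_not_summable by (meson not_le)

end
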